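(* Let $2\le q<\infty$ and let $\mathcal B$ be a Banach space. If there exist $1<p<\infty$ and a constant $C_{p,q}$ such that $$\|\mathcal V_q(\mathcal A)f\|_{L^p(\mathbb R)}\le C_{p,q}\,\|f\|_{L^p(\mathbb R;\mathcal B)},\qquad\forall f\in L^p(\mathbb R;\mathcal B),$$ then $\mathcal B$ is of Rademacher cotype $q$.
   Context: $\|\cdot\|$ denotes the norm of $\mathcal B$. $q$-variation: for a family $(a_t)_{t>0}$ in $\mathcal B$, $$\|(a_t)_{t>0}\|_{V_q(\mathcal B)}=\sup\Big(\|a_{t_0}\|^q+\sum_{k\ge1}\|a_{t_k}-a_{t_{k-1}}\|^q\Big)^{1/q},$$ the supremum over all increasing sequences $(t_k)_{k\ge0}$ of positive reals. Averages on $\mathbb R$: $A_tf(x)=\frac1{2t}\int_{-t}^{t}f(x+y)\,dy$ for $t>0$, and $\mathcal V_q(\mathcal A)f(x)=\|(A_tf(x))_{t>0}\|_{V_q(\mathcal B)}$. Rademacher cotype $q$: there is a constant $C$ such that for all $n$ and $x_1,\dots,x_n\in\mathcal B$, $\big(\sum_{k=1}^n\|x_k\|^q\big)^{1/q}\le C\big(\mathbb E\|\sum_{k=1}^n\varepsilon_kx_k\|^q\big)^{1/q}$, where $(\varepsilon_k)$ are independent random signs with $\mathbb P(\varepsilon_k=\pm1)=1/2$. *)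

theory Defs
  imports "HOL-Probability.Probability"
begin

text \<open>
  The Bochner integral of \<^theory>\<open>HOL-Analysis.Bochner_Integration\<close> is restricted to
  second-countable, i.e. separable, target spaces. For an arbitrary Banach space, Borel
  measurability has to be replaced by strong measurability (being an almost everywhere limit of
  simple functions); otherwise the definitions below repeat the ones of that theory, and
  \<open>strong_integral_eq_integral\<close> records that both integrals agree where the latter applies.
\<close>

definition strongly_measurable :: "'a measure \<Rightarrow> ('a \<Rightarrow> 'b::real_normed_vector) \<Rightarrow> bool" where
  "strongly_measurable M f \<longleftrightarrow>
     (\<exists>s. (\<forall>i::nat. simple_function M (s i)) \<and> (AE x in M. (\<lambda>i. s i x) \<longlonglongrightarrow> f x))"

definition has_strong_integral ::
    "'a measure \<Rightarrow> ('a \<Rightarrow> 'b) \<Rightarrow> 'b::real_normed_vector \<Rightarrow> bool" where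
  "has_strong_integral M f I \<longleftrightarrow>
     strongly_measurable M f \<and>
     (\<exists>s. (\<forall>i::nat. Bochner_Integration.simple_bochner_integrable M (s i)) \<and>
          (\<lambda>i. \<integral>\<^sup>+x. ennreal (norm (f x - s i x)) \<partial>M) \<longlonglongrightarrow> 0 \<and>
          (\<lambda>i. Bochner_Integration.simple_bochner_integral M (s i)) \<longlonglongrightarrow> I)"

definition strong_integral :: "'a measure \<Rightarrow> ('a \<Rightarrow> 'b) \<Rightarrow> 'b::real_normed_vector" where
  "strong_integral M f =
     (if \<exists>I. has_strong_integral M f I then THE I. has_strong_integral M f I else 0)"

lemma strongly_measurable_norm_diff_AE:
  assumes "strongly_measurable M f" "simple_function M s"
  obtains u where "u \<in> borel_measurable M" "AE x in M. ennreal (norm (f x - s x)) = u x"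
proof -
  from assms(1) obtain r where r: "\<And>i::nat. simple_function M (r i)"
    "AE x in M. (\<lambda>i. r i x) \<longlonglongrightarrow> f x"
    unfolding strongly_measurable_def by blast
  define u where "u x = liminf (\<lambda>i. ennreal (norm (r i x - s x)))" for x
  have "(\<lambda>x. ennreal (norm (r i x - s x))) \<in> borel_measurable M" for i
    using simple_function_compose2[OF r(1) assms(2), of "\<lambda>a b. ennreal (norm (a - b))"]
    by (rule borel_measurable_simple_function)
  then have "u \<in> borel_measurable M"
    unfolding u_def by measurable
  moreover have "AE x in M. ennreal (norm (f x - s x)) = u x"
    using r(2)
  proof eventually_elim
    case (elim x)
    then have "(\<lambda>i. ennreal (norm (r i x - s x))) \<longlonglongrightarrow> ennreal (norm (f x - s x))"
      by (intro tendsto_intros tendsto_ennrealI)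
    then show ?case
      unfolding u_def by (intro lim_imp_Liminf[symmetric]) simp_all
  qed
  ultimately show ?thesis using that by blast
qed

lemma has_strong_integral_unique:
  fixes I J :: "'b::real_normed_vector"
  assumes "has_strong_integral M f I" "has_strong_integral M f J"
  shows "I = J"
proof -
  let ?B = "Bochner_Integration.simple_bochner_integral M"
  let ?i = "Bochner_Integration.simple_bochner_integrable M"
  obtain s where s: "\<And>i::nat. ?i (s i)"
    "(\<lambda>i. \<integral>\<^sup>+x. ennreal (norm (f x - s i x)) \<partial>M) \<longlonglongrightarrow> 0" "(\<lambda>i. ?B (s i)) \<longlonglongrightarrow> I"
    using assms(1) unfolding has_strong_integral_def by blast
  obtain t where t: "\<And>i::nat. ?i (t i)"
    "(\<lambda>i. \<integral>\<^sup>+x. ennreal (norm (f x - t i x)) \<partial>M) \<longlonglongrightarrow> 0" "(\<lambda>i. ?B (t i)) \<longlonglongrightarrow> J"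
    using assms(2) unfolding has_strong_integral_def by blast
  have f: "strongly_measurable M f" using assms(1) by (simp add: has_strong_integral_def)
  have sf: "\<And>i. simple_function M (s i)" "\<And>i. simple_function M (t i)"
    using s(1) t(1) by (auto simp: Bochner_Integration.simple_bochner_integrable.simps)
  let ?S = "\<lambda>i. \<integral>\<^sup>+x. ennreal (norm (f x - s i x)) \<partial>M"
  let ?T = "\<lambda>i. \<integral>\<^sup>+x. ennreal (norm (f x - t i x)) \<partial>M"
  have le: "ennreal (norm (?B (s i) - ?B (t i))) \<le> ?S i + ?T i" for i
  proof -
    obtain u where u: "u \<in> borel_measurable M" "AE x in M. ennreal (norm (f x - s i x)) = u x"
      using strongly_measurable_norm_diff_AE[OF f sf(1)] .
    obtain v where v: "v \<in> borel_measurable M" "AE x in M. ennreal (norm (f x - t i x)) = v x"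
      using strongly_measurable_norm_diff_AE[OF f sf(2)] .
    have d: "?i (\<lambda>x. s i x - t i x)" "?i (\<lambda>x. norm (s i x - t i x))"
      using Bochner_Integration.simple_bochner_integrable_compose2[OF _ s(1) t(1), of "(-)"]
        Bochner_Integration.simple_bochner_integrable_compose2[OF _ s(1) t(1), of "\<lambda>a b. norm (a - b)"] by auto
    have "norm (?B (s i) - ?B (t i)) \<le> ?B (\<lambda>x. norm (s i x - t i x))"
      using Bochner_Integration.simple_bochner_integral_norm_bound[OF d(1)]
      by (simp add: Bochner_Integration.simple_bochner_integral_diff s t)
    then have "ennreal (norm (?B (s i) - ?B (t i))) \<le> ennreal (?B (\<lambda>x. norm (s i x - t i x)))"
      by (rule ennreal_leI)
    also have "\<dots> = (\<integral>\<^sup>+x. norm (s i x - t i x) \<partial>M)"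
      by (rule Bochner_Integration.simple_bochner_integral_eq_nn_integral[OF d(2)]) auto
    also have "\<dots> \<le> (\<integral>\<^sup>+x. u x + v x \<partial>M)"
    proof (rule nn_integral_mono_AE)
      show "AE x in M. ennreal (norm (s i x - t i x)) \<le> u x + v x"
        using u(2) v(2)
      proof eventually_elim
        case (elim x)
        have "norm (s i x - t i x) \<le> norm (f x - s i x) + norm (f x - t i x)"
          by (metis dual_order.refl norm_diff_triangle_le norm_minus_commute)
        then show ?case
          by (metis elim ennreal_leI ennreal_plus norm_ge_zero)
      qed
    qed
    also have "\<dots> = (\<integral>\<^sup>+x. u x \<partial>M) + (\<integral>\<^sup>+x. v x \<partial>M)"
      by (rule nn_integral_add[OF u(1) v(1)])
    also have "\<dots> = ?S i + ?T i"
      using nn_integral_cong_AE[OF u(2)] nn_integral_cong_AE[OF v(2)] by simp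
    finally show ?thesis .
  qed
  have "(\<lambda>i. ennreal (norm (?B (s i) - ?B (t i)))) \<longlonglongrightarrow> ennreal 0"
  proof (rule tendsto_sandwich)
    show "(\<lambda>_. 0) \<longlonglongrightarrow> ennreal 0" by simp
    show "(\<lambda>i. ?S i + ?T i) \<longlonglongrightarrow> ennreal 0"
      using tendsto_add[OF s(2) t(2)] by simp
  qed (use le in auto)
  then have "(\<lambda>i. norm (?B (s i) - ?B (t i))) \<longlonglongrightarrow> 0"
    by (simp flip: ennreal_0)
  moreover have "(\<lambda>i. norm (?B (s i) - ?B (t i))) \<longlonglongrightarrow> norm (I - J)"
    by (intro tendsto_intros s t)
  ultimately have "norm (I - J) = 0" by (metis LIMSEQ_unique)
  then show ?thesis by simp
qed

lemma has_bochner_integral_imp_has_strong_integral: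
  assumes "has_bochner_integral M f I"
  shows "has_strong_integral M f I"
proof -
  have "f \<in> borel_measurable M" using assms by (rule borel_measurable_has_bochner_integral)
  then obtain s where "\<And>i::nat. simple_function M (s i)" "\<And>x. x \<in> space M \<Longrightarrow> (\<lambda>i. s i x) \<longlonglongrightarrow> f x"
    using borel_measurable_implies_sequence_metric by (metis (no_types))
  then have "strongly_measurable M f" unfolding strongly_measurable_def by blast
  then show ?thesis
    using assms unfolding has_strong_integral_def has_bochner_integral.simps by blast
qed

lemma strong_integral_eq_integral:
  assumes "integrable M f"
  shows "strong_integral M f = integral\<^sup>L M f"
proof -
  have *: "has_strong_integral M f (integral\<^sup>L M f)"
    using assms by (intro has_bochner_integral_imp_has_strong_integral has_bochner_integral_integrable)
  show ?thesis
    unfolding strong_integral_def using * has_strong_integral_unique[OF _ *]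
    by (metis the_equality)
qed

text \<open>Only used with a positive exponent.\<close>

definition ennreal_powr :: "ennreal \<Rightarrow> real \<Rightarrow> ennreal" where
  "ennreal_powr x a = (if x = \<infinity> then \<infinity> else ennreal (enn2real x powr a))"

definition Lp_norm :: "'a measure \<Rightarrow> real \<Rightarrow> ('a \<Rightarrow> ennreal) \<Rightarrow> ennreal" where
  "Lp_norm M p g = ennreal_powr (\<integral>\<^sup>+x. ennreal_powr (g x) p \<partial>M) (1 / p)"

text \<open>Elements of $L^p$ are represented by functions, not by almost everywhere classes.\<close>

definition Lp_space :: "'a measure \<Rightarrow> real \<Rightarrow> ('a \<Rightarrow> 'b::real_normed_vector) set" where
  "Lp_space M p =
     {f. strongly_measurable M f \<and> Lp_norm M p (\<lambda>x. ennreal (norm (f x))) < \<infinity>}"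

text \<open>Only the values \<open>a t\<close> with \<open>t > 0\<close> enter; the variation may be infinite.\<close>

definition q_variation :: "real \<Rightarrow> (real \<Rightarrow> 'b::real_normed_vector) \<Rightarrow> ennreal" where
  "q_variation q a =
     (SUP t\<in>{t :: nat \<Rightarrow> real. strict_mono t \<and> (\<forall>k. 0 < t k)}.
        ennreal_powr
          (ennreal (norm (a (t 0)) powr q)
            + (\<Sum>k. ennreal (norm (a (t (Suc k)) - a (t k)) powr q)))
          (1 / q))"

definition average :: "(real \<Rightarrow> 'b::real_normed_vector) \<Rightarrow> real \<Rightarrow> real \<Rightarrow> 'b" where
  "average f t x =
     (1 / (2 * t)) *\<^sub>R strong_integral lebesgue (\<lambda>y. indicator {-t..t} y *\<^sub>R f (x + y))"

definition average_variation :: "real \<Rightarrow> (real \<Rightarrow> 'b::real_normed_vector) \<Rightarrow> real \<Rightarrow> ennreal" where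
  "average_variation q f x = q_variation q (\<lambda>t. average f t x)"

definition rademacher_signs :: "nat \<Rightarrow> (nat \<Rightarrow> real) pmf" where
  "rademacher_signs n = Pi_pmf {1..n} 0 (\<lambda>_. pmf_of_set {-1, 1})"

definition rademacher_cotype :: "real \<Rightarrow> 'b::real_normed_vector itself \<Rightarrow> bool" where
  "rademacher_cotype q _ \<longleftrightarrow>
     (\<exists>C::real. \<forall>(n::nat) (x :: nat \<Rightarrow> 'b).
        (\<Sum>k=1..n. norm (x k) powr q) powr (1 / q)
          \<le> C * (measure_pmf.expectation (rademacher_signs n)
                   (\<lambda>\<epsilon>. norm (\<Sum>k=1..n. \<epsilon> k *\<^sub>R x k) powr q)) powr (1 / q))"

end

theory Submission
  imports Defs
begin

text \<open>
  Given vectors \<open>v 1, \<dots>, v n\<close>, let \<open>f\<close> be the signed sum of the \<open>v j\<close> modulated by square waves of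
  rapidly growing frequency \<open>H ^ j\<close>, cut off to \<open>[0, 1)\<close>. Averaging over a radius \<open>1 / H ^ (k + 1)\<close>
  annihilates the waves with \<open>j > k\<close> (the radius is an odd multiple of their half period, as \<open>H\<close> is
  odd) and, at most points, leaves the waves with \<open>j \<le> k\<close> unchanged. Consecutive averages thus differ
  by \<open>\<plusminus> v k\<close>, so the \<open>q\<close>-variation is at least the \<open>l^q\<close> norm of \<open>v\<close> on a set of measure at least
  \<open>1/2\<close>. Averaging the assumed inequality over the signs turns its right-hand side into the \<open>p\<close>-th
  moment of the Rademacher sum, which a Kahane inequality, obtained from two-point
  hypercontractivity, compares with the \<open>q\<close>-th moment.
\<close>

subsection \<open>Moments of Rademacher sums\<close>

lemma set_rademacher_signs: "set_pmf (rademacher_signs n) = PiE_dflt {1..n} 0 (\<lambda>_. {-1, 1})"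
  unfolding rademacher_signs_def by (subst set_Pi_pmf) (auto simp: set_pmf_of_set)

lemma finite_rademacher_signs [simp]: "finite (set_pmf (rademacher_signs n))"
  unfolding set_rademacher_signs by (intro finite_PiE_dflt) auto

lemma integrable_rademacher_signs [simp]:
  fixes g :: "(nat \<Rightarrow> real) \<Rightarrow> 'c::{banach, second_countable_topology}"
  shows "integrable (measure_pmf (rademacher_signs n)) g"
  by (intro integrable_measure_pmf_finite) simp

lemma rademacher_signs_0: "rademacher_signs 0 = return_pmf (\<lambda>_. 0)"
  unfolding rademacher_signs_def by simp

lemma expectation_rademacher_signs_Suc:
  fixes g :: "(nat \<Rightarrow> real) \<Rightarrow> real"
  shows "measure_pmf.expectation (rademacher_signs (Suc n)) g =
    (measure_pmf.expectation (rademacher_signs n) (\<lambda>e. g (e(Suc n := 1))) +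
     measure_pmf.expectation (rademacher_signs n) (\<lambda>e. g (e(Suc n := -1)))) / 2"
proof -
  have "rademacher_signs (Suc n) =
      pmf_of_set {-1, 1} \<bind> (\<lambda>c. map_pmf (\<lambda>e. e(Suc n := c)) (rademacher_signs n))"
    using Pi_pmf_insert'[of "{1..n}" "Suc n" 0 "\<lambda>_. pmf_of_set {-1, 1 :: real}"]
    by (simp add: rademacher_signs_def map_pmf_def atLeastAtMostSuc_conv)
  then show ?thesis
    by (simp add: pmf_expectation_bind_pmf_of_set field_simps)
qed

lemma rademacher_sum_Suc:
  fixes x :: "nat \<Rightarrow> 'b::real_vector"
  shows "(\<Sum>k=1..Suc n. (e(Suc n := c)) k *\<^sub>R x k) = c *\<^sub>R x (Suc n) + (\<Sum>k=1..n. e k *\<^sub>R x k)"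
proof -
  have "(\<Sum>k=1..n. (e(Suc n := c)) k *\<^sub>R x k) = (\<Sum>k=1..n. e k *\<^sub>R x k)"
    by (intro sum.cong) auto
  then show ?thesis by (simp add: add.commute)
qed

text \<open>Conditioning on the last sign. Formulated for functions of the vector sum, so that
  inductions on \<open>n\<close> can absorb the last vector into \<open>g\<close>.\<close>

lemma expectation_rademacher_sum_Suc:
  fixes g :: "'b::real_vector \<Rightarrow> real"
  shows "measure_pmf.expectation (rademacher_signs (Suc n)) (\<lambda>e. g (\<Sum>k=1..Suc n. e k *\<^sub>R x k)) =
    (measure_pmf.expectation (rademacher_signs n) (\<lambda>e. g (x (Suc n) + (\<Sum>k=1..n. e k *\<^sub>R x k))) +
     measure_pmf.expectation (rademacher_signs n) (\<lambda>e. g (- x (Suc n) + (\<Sum>k=1..n. e k *\<^sub>R x k)))) / 2"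
  unfolding expectation_rademacher_signs_Suc rademacher_sum_Suc by simp

text \<open>The law of the signs is symmetric in each coordinate. In the induction a factor
  \<open>s (Suc n) = -1\<close> merely swaps the two halves of the average over the last sign;
  \<open>g\<close> is arbitrary so that it can be translated by \<open>x (Suc n)\<close>.\<close>

lemma expectation_rademacher_signs_flip:
  fixes g :: "'b::real_vector \<Rightarrow> real"
  assumes "\<And>k. s k = 1 \<or> s k = (-1::real)"
  shows "measure_pmf.expectation (rademacher_signs n) (\<lambda>e. g (\<Sum>k=1..n. e k *\<^sub>R s k *\<^sub>R x k)) =
    measure_pmf.expectation (rademacher_signs n) (\<lambda>e. g (\<Sum>k=1..n. e k *\<^sub>R x k))"
proof (induction n arbitrary: g)
  case (Suc n)
  have IH: "measure_pmf.expectation (rademacher_signs n) (\<lambda>e. g (a + (\<Sum>k=1..n. e k *\<^sub>R s k *\<^sub>R x k))) =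
    measure_pmf.expectation (rademacher_signs n) (\<lambda>e. g (a + (\<Sum>k=1..n. e k *\<^sub>R x k)))" for a
    by (rule Suc.IH[of "\<lambda>y. g (a + y)"])
  show ?case
    unfolding expectation_rademacher_sum_Suc[of n g "\<lambda>k. s k *\<^sub>R x k"]
      expectation_rademacher_sum_Suc[of n g x] IH
    using assms[of "Suc n"] by (auto simp: add.commute)
qed (simp add: rademacher_signs_0)

section \<open>Two-point inequality and hypercontractivity\<close>

lemma powr_convex_combination:
  fixes a b s l :: real
  assumes "1 \<le> s" "0 \<le> a" "0 \<le> b" "0 \<le> l" "l \<le> 1"
  shows "(l * a + (1 - l) * b) powr s \<le> l * a powr s + (1 - l) * b powr s"
proof -
  \<comment> \<open>For the endpoints \<open>a = 0\<close> and \<open>b = 0\<close>, which lie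
    outside the open half-line where convexity is invoked: \<open>m powr s \<le> m\<close> on the
    unit interval.\<close>
  have scale: "(m * c) powr s \<le> m * c powr s" if "0 \<le> m" "m \<le> 1" "0 \<le> c" for m c :: real
  proof (cases "m = 0")
    case False
    have "m powr s \<le> m powr 1"
      using that assms False by (intro powr_mono') auto
    then show ?thesis
      using that False by (auto simp: powr_mult intro!: mult_right_mono)
  qed auto
  consider "a = 0" | "b = 0" | "0 < a" "0 < b"
    using assms by linarith
  then show ?thesis
  proof cases
    case 3
    have "convex_on {0<..} (\<lambda>x::real. x powr s)"
      using assms by (intro powr_convex)
    from convex_onD[OF this, of "1 - l" a b] 3 assms show ?thesis
      by (simp add: algebra_simps)
  qed (use assms scale[of l a] scale[of "1 - l" b] in auto)
qed

text \<open>The point \<open>g + r *\<^sub>R y\<close> is the convex combination of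
  \<open>g + y\<close> and \<open>g - y\<close> with weights \<open>(1 + r) / 2\<close> and
  \<open>(1 - r) / 2\<close>. This reduces the two-point inequality in a normed space to one about
  two real numbers.\<close>

lemma norm_contracted_pair_powr_le:
  fixes g y :: "'b::real_normed_vector"
  assumes "1 \<le> s" "\<bar>r\<bar> \<le> 1"
  shows "norm (g + r *\<^sub>R y) powr s \<le>
    (1 + r) / 2 * norm (g + y) powr s + (1 - r) / 2 * norm (g - y) powr s"
proof -
  have "g + r *\<^sub>R y = ((1 + r) / 2) *\<^sub>R (g + y) + ((1 - r) / 2) *\<^sub>R (g - y)"
    using scaleR_half_double[of g] scaleR_half_double[of "r *\<^sub>R y"]
    by (simp add: scaleR_add_right scaleR_diff_right add_divide_distrib diff_divide_distrib
        scaleR_add_left scaleR_diff_left del: scaleR_half_double) (simp add: add_ac)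
  then have "norm (g + r *\<^sub>R y) \<le> norm (((1 + r) / 2) *\<^sub>R (g + y)) + norm (((1 - r) / 2) *\<^sub>R (g - y))"
    by (metis norm_triangle_ineq)
  also have "\<dots> = (1 + r) / 2 * norm (g + y) + (1 - (1 + r) / 2) * norm (g - y)"
  proof -
    have "\<bar>(1 + r) / 2\<bar> = (1 + r) / 2" "\<bar>(1 - r) / 2\<bar> = 1 - (1 + r) / 2"
      using assms by (auto simp: abs_if field_simps)
    then show ?thesis by (simp only: norm_scaleR)
  qed
  finally have "norm (g + r *\<^sub>R y) \<le> (1 + r) / 2 * norm (g + y) + (1 - (1 + r) / 2) * norm (g - y)" .
  then have "norm (g + r *\<^sub>R y) powr s \<le>
      ((1 + r) / 2 * norm (g + y) + (1 - (1 + r) / 2) * norm (g - y)) powr s"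
    using assms by (intro powr_mono2) auto
  also have "\<dots> \<le> (1 + r) / 2 * norm (g + y) powr s + (1 - (1 + r) / 2) * norm (g - y) powr s"
    using assms by (intro powr_convex_combination) auto
  finally show ?thesis by (simp add: field_simps)
qed

text \<open>Bonami's two-point inequality from \<open>L^2\<close> to \<open>L^4\<close>. In terms of
  the mean \<open>u\<close> and the half difference \<open>v\<close>, the choice
  \<open>r\<^sup>2 = 1 / 3\<close> makes the mixed terms on both sides equal, and only a negative
  multiple of \<open>v ^ 4\<close> remains.\<close>

lemma two_point_real:
  fixes a b r :: real
  assumes "3 * r\<^sup>2 = 1"
  shows "((1 + r) / 2 * a + (1 - r) / 2 * b) ^ 4 + ((1 - r) / 2 * a + (1 + r) / 2 * b) ^ 4
    \<le> 2 * ((a\<^sup>2 + b\<^sup>2) / 2)\<^sup>2"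
proof -
  define u v where "u = (a + b) / 2" and "v = (a - b) / 2"
  have r: "r\<^sup>2 = 1 / 3" "r ^ 4 = 1 / 9"
    using assms by (auto simp: power4_eq_xxxx power2_eq_square) algebra
  have "(1 + r) / 2 * a + (1 - r) / 2 * b = u + r * v" "(1 - r) / 2 * a + (1 + r) / 2 * b = u - r * v"
    "(a\<^sup>2 + b\<^sup>2) / 2 = u\<^sup>2 + v\<^sup>2"
    by (simp_all add: u_def v_def field_simps power2_eq_square)
  moreover have "(u + r * v) ^ 4 + (u - r * v) ^ 4 = 2 * (u ^ 4 + 6 * r\<^sup>2 * u\<^sup>2 * v\<^sup>2 + r ^ 4 * v ^ 4)"
    by algebra
  moreover have "\<dots> = 2 * (u\<^sup>2 + v\<^sup>2)\<^sup>2 - 16 / 9 * v ^ 4"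
    unfolding r by algebra
  moreover have "0 \<le> v ^ 4" by simp
  ultimately show ?thesis by (simp only:)
qed

text \<open>The scalar inequality is applied to the powers \<open>s / 2\<close> of the two norms,
  since their squares and fourth powers are the powers \<open>s\<close> and \<open>2 * s\<close>.
  The hypothesis \<open>2 \<le> s\<close> makes \<open>s / 2\<close> a convex exponent.\<close>

lemma two_point_hypercontractive:
  fixes g y :: "'b::real_normed_vector"
  assumes "2 \<le> s" "3 * r\<^sup>2 = (1::real)" "0 \<le> r"
  shows "norm (g + r *\<^sub>R y) powr (2 * s) + norm (g - r *\<^sub>R y) powr (2 * s)
    \<le> 2 * ((norm (g + y) powr s + norm (g - y) powr s) / 2)\<^sup>2"
proof -
  have "r\<^sup>2 \<le> 1\<^sup>2" using assms by simp
  then have r: "r \<le> 1" by (rule power2_le_imp_le) simp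
  define a b where "a = norm (g + y) powr (s / 2)" and "b = norm (g - y) powr (s / 2)"
  have eq: "norm z powr (2 * s) = (norm z powr (s / 2)) ^ 4" "norm z powr s = (norm z powr (s / 2))\<^sup>2"
    for z :: 'b
    by (cases "z = 0"; simp add: powr_def field_simps flip: exp_of_nat_mult)+
  have "norm (g + r *\<^sub>R y) powr (s / 2) \<le> (1 + r) / 2 * a + (1 - r) / 2 * b"
    "norm (g - r *\<^sub>R y) powr (s / 2) \<le> (1 - r) / 2 * a + (1 + r) / 2 * b"
    using norm_contracted_pair_powr_le[of "s / 2" r g y]
      norm_contracted_pair_powr_le[of "s / 2" "-r" g y] assms r
    by (auto simp: a_def b_def)
  then have "norm (g + r *\<^sub>R y) powr (2 * s) + norm (g - r *\<^sub>R y) powr (2 * s)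
      \<le> ((1 + r) / 2 * a + (1 - r) / 2 * b) ^ 4 + ((1 - r) / 2 * a + (1 + r) / 2 * b) ^ 4"
    unfolding eq by (intro add_mono power_mono) auto
  also have "\<dots> \<le> 2 * ((a\<^sup>2 + b\<^sup>2) / 2)\<^sup>2"
    using assms by (intro two_point_real) 
  finally show ?thesis unfolding eq a_def b_def .
qed

text \<open>Minkowski's inequality for the Euclidean plane: the norm of an integral is at most the
  integral of the norm, for the complex function with real part \<open>P\<close> and imaginary part
  \<open>Q\<close>.\<close>

lemma sum_squares_expectation_le:
  fixes P Q :: "'a \<Rightarrow> real"
  assumes "finite (set_pmf M)"
  shows "(measure_pmf.expectation M P)\<^sup>2 + (measure_pmf.expectation M Q)\<^sup>2
    \<le> (measure_pmf.expectation M (\<lambda>w. sqrt ((P w)\<^sup>2 + (Q w)\<^sup>2)))\<^sup>2"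
proof -
  have i: "integrable (measure_pmf M) f" for f :: "'a \<Rightarrow> complex"
    by (intro integrable_measure_pmf_finite assms)
  have "Re (measure_pmf.expectation M (\<lambda>w. Complex (P w) (Q w))) = measure_pmf.expectation M P"
    "Im (measure_pmf.expectation M (\<lambda>w. Complex (P w) (Q w))) = measure_pmf.expectation M Q"
    by (simp_all add: i flip: integral_Re integral_Im)
  then have "(measure_pmf.expectation M P)\<^sup>2 + (measure_pmf.expectation M Q)\<^sup>2 =
      (norm (measure_pmf.expectation M (\<lambda>w. Complex (P w) (Q w))))\<^sup>2"
    by (simp add: cmod_power2)
  also have "\<dots> \<le> (measure_pmf.expectation M (\<lambda>w. norm (Complex (P w) (Q w))))\<^sup>2"
    by (intro power_mono integral_norm_bound) simp
  finally show ?thesis by (simp add: complex_norm)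
qed

text \<open>Tensorisation of the two-point inequality. The vector \<open>a\<close> carries the
  summands whose signs are already fixed: the induction hypothesis is used at
  \<open>a + r *\<^sub>R x (Suc n)\<close> and \<open>a - r *\<^sub>R x (Suc n)\<close>, and
  Minkowski's inequality moves the sum of the two squares inside the expectation over the other
  signs.\<close>

lemma rademacher_hypercontractive:
  fixes x :: "nat \<Rightarrow> 'b::real_normed_vector"
  assumes "2 \<le> s" "3 * r\<^sup>2 = (1::real)" "0 \<le> r"
  shows "measure_pmf.expectation (rademacher_signs n)
      (\<lambda>e. norm (a + r *\<^sub>R (\<Sum>k=1..n. e k *\<^sub>R x k)) powr (2 * s))
    \<le> (measure_pmf.expectation (rademacher_signs n) (\<lambda>e. norm (a + (\<Sum>k=1..n. e k *\<^sub>R x k)) powr s))\<^sup>2"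
proof (induction n arbitrary: a)
  case 0
  then show ?case
    by (simp add: rademacher_signs_0 powr_def power2_eq_square flip: exp_add)
next
  case (Suc n)
  let ?E = "measure_pmf.expectation (rademacher_signs n)"
  let ?S = "\<lambda>e. \<Sum>k=1..n. e k *\<^sub>R x k"
  let ?y = "x (Suc n)"
  define P where "P e = norm (a + r *\<^sub>R ?y + ?S e) powr s" for e
  define Q where "Q e = norm (a - r *\<^sub>R ?y + ?S e) powr s" for e
  have "?E (\<lambda>e. norm (a + r *\<^sub>R (?y + ?S e)) powr (2 * s)) \<le> (?E P)\<^sup>2"
    using Suc.IH[of "a + r *\<^sub>R ?y"] by (simp add: P_def[abs_def] algebra_simps)
  moreover have "?E (\<lambda>e. norm (a + r *\<^sub>R (- ?y + ?S e)) powr (2 * s)) \<le> (?E Q)\<^sup>2"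
    using Suc.IH[of "a - r *\<^sub>R ?y"] by (simp add: Q_def[abs_def] algebra_simps)
  moreover have "(?E P)\<^sup>2 + (?E Q)\<^sup>2 \<le> (?E (\<lambda>e. sqrt ((P e)\<^sup>2 + (Q e)\<^sup>2)))\<^sup>2"
    by (intro sum_squares_expectation_le) simp
  moreover have "(?E (\<lambda>e. sqrt ((P e)\<^sup>2 + (Q e)\<^sup>2)))\<^sup>2 \<le>
      2 * ((?E (\<lambda>e. norm (a + (?y + ?S e)) powr s) + ?E (\<lambda>e. norm (a + (- ?y + ?S e)) powr s)) / 2)\<^sup>2"
  proof -
    \<comment> \<open>For fixed signs \<open>e\<close> this is the two-point inequality centred at
      \<open>a + ?S e\<close>.\<close>
    have "?E (\<lambda>e. sqrt ((P e)\<^sup>2 + (Q e)\<^sup>2)) \<le>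
        ?E (\<lambda>e. sqrt 2 * ((norm (a + (?y + ?S e)) powr s + norm (a + (- ?y + ?S e)) powr s) / 2))"
    proof (intro integral_mono)
      fix e
      have "(P e)\<^sup>2 + (Q e)\<^sup>2 = norm ((a + ?S e) + r *\<^sub>R ?y) powr (2 * s) + norm ((a + ?S e) - r *\<^sub>R ?y) powr (2 * s)"
        unfolding P_def Q_def by (simp add: algebra_simps powr_def power2_eq_square flip: exp_add)
      also have "\<dots> \<le> 2 * ((norm ((a + ?S e) + ?y) powr s + norm ((a + ?S e) - ?y) powr s) / 2)\<^sup>2"
        using assms by (rule two_point_hypercontractive)
      also have "\<dots> = (sqrt 2 * ((norm (a + (?y + ?S e)) powr s + norm (a + (- ?y + ?S e)) powr s) / 2))\<^sup>2"
        unfolding power_mult_distrib by (simp add: algebra_simps)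
      finally show "sqrt ((P e)\<^sup>2 + (Q e)\<^sup>2) \<le>
          sqrt 2 * ((norm (a + (?y + ?S e)) powr s + norm (a + (- ?y + ?S e)) powr s) / 2)"
        by (intro real_le_lsqrt) auto
    qed simp_all
    then have "(?E (\<lambda>e. sqrt ((P e)\<^sup>2 + (Q e)\<^sup>2)))\<^sup>2 \<le>
        (?E (\<lambda>e. sqrt 2 * ((norm (a + (?y + ?S e)) powr s + norm (a + (- ?y + ?S e)) powr s) / 2)))\<^sup>2"
      by (intro power_mono) auto
    moreover have "?E (\<lambda>e. sqrt 2 * ((norm (a + (?y + ?S e)) powr s + norm (a + (- ?y + ?S e)) powr s) / 2)) =
        sqrt 2 * ((?E (\<lambda>e. norm (a + (?y + ?S e)) powr s) + ?E (\<lambda>e. norm (a + (- ?y + ?S e)) powr s)) / 2)"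
      by simp
    ultimately show ?thesis
      by (simp only: power_mult_distrib) simp
  qed
  ultimately show ?case
    unfolding expectation_rademacher_sum_Suc[of n "\<lambda>z. norm (a + r *\<^sub>R z) powr (2 * s)"]
      expectation_rademacher_sum_Suc[of n "\<lambda>z. norm (a + z) powr s"]
    by simp
qed

section \<open>Comparison of moments\<close>

text \<open>Hypercontractivity at \<open>a = 0\<close>: the contraction
  \<open>r = 1 / sqrt 3\<close> comes out of the norm as the factor
  \<open>3 powr (- s)\<close>.\<close>

lemma rademacher_moment_double:
  fixes x :: "nat \<Rightarrow> 'b::real_normed_vector"
  assumes "2 \<le> s"
  shows "measure_pmf.expectation (rademacher_signs n) (\<lambda>e. norm (\<Sum>k=1..n. e k *\<^sub>R x k) powr (2 * s))
    \<le> 3 powr s * (measure_pmf.expectation (rademacher_signs n) (\<lambda>e. norm (\<Sum>k=1..n. e k *\<^sub>R x k) powr s))\<^sup>2"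
proof -
  define r :: real where "r = 1 / sqrt 3"
  have r: "3 * r\<^sup>2 = 1" "0 \<le> r" by (simp_all add: r_def power_divide)
  have "r powr (2 * s) = 3 powr (- s)"
    by (simp add: r_def powr_half_sqrt[symmetric] powr_powr flip: powr_minus_divide)
  then have "3 powr (- s) * measure_pmf.expectation (rademacher_signs n) (\<lambda>e. norm (\<Sum>k=1..n. e k *\<^sub>R x k) powr (2 * s))
    = measure_pmf.expectation (rademacher_signs n) (\<lambda>e. norm (0 + r *\<^sub>R (\<Sum>k=1..n. e k *\<^sub>R x k)) powr (2 * s))"
    using r by (simp add: powr_mult)
  also note rademacher_hypercontractive[OF assms r]
  finally show ?thesis by (simp add: powr_minus field_simps)
qed

text \<open>Iterated doubling of the exponent, starting from \<open>q\<close>. Each step squares the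
  previous constant and multiplies it by \<open>3 powr s\<close>, so that it depends on
  \<open>m\<close> and \<open>q\<close> but not on \<open>n\<close> or the vectors.\<close>

lemma rademacher_moment_power_two:
  assumes "2 \<le> q"
  shows "\<exists>K\<ge>0. \<forall>n (x :: nat \<Rightarrow> 'b::real_normed_vector).
    measure_pmf.expectation (rademacher_signs n) (\<lambda>e. norm (\<Sum>k=1..n. e k *\<^sub>R x k) powr (2 ^ m * q))
    \<le> K * (measure_pmf.expectation (rademacher_signs n) (\<lambda>e. norm (\<Sum>k=1..n. e k *\<^sub>R x k) powr q)) ^ (2 ^ m)"
proof (induction m)
  case 0
  show ?case by (rule exI[of _ 1]) simp
next
  case (Suc m)
  then obtain K where K: "K \<ge> 0" "\<And>n (x :: nat \<Rightarrow> 'b).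
    measure_pmf.expectation (rademacher_signs n) (\<lambda>e. norm (\<Sum>k=1..n. e k *\<^sub>R x k) powr (2 ^ m * q))
    \<le> K * (measure_pmf.expectation (rademacher_signs n) (\<lambda>e. norm (\<Sum>k=1..n. e k *\<^sub>R x k) powr q)) ^ (2 ^ m)"
    by blast
  define s where "s = 2 ^ m * q"
  have "1 * 2 \<le> s"
    unfolding s_def using assms by (intro mult_mono) auto
  then have s: "2 \<le> s" by simp
  show ?case
  proof (intro exI[of _ "3 powr s * K\<^sup>2"] conjI allI)
    fix n and x :: "nat \<Rightarrow> 'b"
    let ?E = "\<lambda>t. measure_pmf.expectation (rademacher_signs n) (\<lambda>e. norm (\<Sum>k=1..n. e k *\<^sub>R x k) powr t)"
    have "?E (2 ^ Suc m * q) = ?E (2 * s)" by (simp add: s_def algebra_simps)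
    also have "\<dots> \<le> 3 powr s * (?E s)\<^sup>2" by (rule rademacher_moment_double[OF s])
    also have "\<dots> \<le> 3 powr s * (K * ?E q ^ 2 ^ m)\<^sup>2"
      using K(2)[of n x] by (intro mult_left_mono power_mono) (auto simp: s_def)
    also have "\<dots> = 3 powr s * K\<^sup>2 * ?E q ^ 2 ^ Suc m"
      by (simp add: power_mult_distrib flip: power_mult) (simp add: mult.commute)
    finally show "?E (2 ^ Suc m * q) \<le> 3 powr s * K\<^sup>2 * ?E q ^ 2 ^ Suc m" .
  qed simp
qed

text \<open>The factor 2 comes from the crude bound \<open>u powr \<theta> \<le> 1 + u\<close> in place of Jensen's inequality.\<close>

lemma expectation_powr_mono_exponent:
  fixes Z :: "'a \<Rightarrow> real"
  assumes fin: "finite (set_pmf M)" and Z: "\<And>w. 0 \<le> Z w" and p: "0 < p" "p \<le> r"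
  shows "measure_pmf.expectation M (\<lambda>w. Z w powr p)
    \<le> 2 * (measure_pmf.expectation M (\<lambda>w. Z w powr r)) powr (p / r)"
proof -
  have i: "integrable (measure_pmf M) f" for f :: "'a \<Rightarrow> real"
    by (intro integrable_measure_pmf_finite fin)
  define m where "m = measure_pmf.expectation M (\<lambda>w. Z w powr r)"
  have "0 \<le> m" unfolding m_def by simp
  show ?thesis
  proof (cases "m = 0")
    case True
    then have "AE w in M. Z w powr r = 0"
      unfolding m_def by (subst (asm) integral_nonneg_eq_0_iff_AE) (auto simp: i)
    then have "measure_pmf.expectation M (\<lambda>w. Z w powr p) = measure_pmf.expectation M (\<lambda>_. 0)"
      by (intro integral_cong_AE) auto
    then show ?thesis by simp
  next
    case False
    with \<open>0 \<le> m\<close> have m: "0 < m" by simp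
    have "Z w powr p \<le> m powr (p / r) * (1 + Z w powr r / m)" for w
    proof -
      \<comment> \<open>After division by \<open>m\<close> the variable \<open>u\<close> has mean 1,
        so \<open>1 + u\<close> has mean 2.\<close>
      define u where "u = Z w powr r / m"
      have u: "0 \<le> u" using m by (simp add: u_def)
      have "Z w powr p = (m * u) powr (p / r)"
        using m p by (simp add: u_def powr_powr)
      also have "\<dots> = m powr (p / r) * u powr (p / r)"
        using m u by (simp add: powr_mult)
      also have "u powr (p / r) \<le> 1 + u"
      proof (cases "u \<le> 1")
        case True
        then have "u powr (p / r) \<le> 1" using p u by (intro powr_le1) auto
        then show ?thesis using u by simp
      next
        case False
        then have "u powr (p / r) \<le> u powr 1" using p by (intro powr_mono) auto
        then show ?thesis using u by simp
      qed
      finally show ?thesis using m by (simp add: u_def)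
    qed
    then have "measure_pmf.expectation M (\<lambda>w. Z w powr p)
      \<le> measure_pmf.expectation M (\<lambda>w. m powr (p / r) * (1 + Z w powr r / m))"
      by (intro integral_mono) (auto simp: i)
    also have "\<dots> = m powr (p / r) * 2"
      using m by (simp add: i) (simp add: m_def)
    finally show ?thesis by (simp add: m_def mult.commute)
  qed
qed

text \<open>The \<open>p\<close>-th moment is bounded by a moment of order
  \<open>r = 2 ^ m * q \<ge> p\<close>, which \<open>m\<close> doublings lead back to the
  \<open>q\<close>-th. This covers \<open>p < q\<close> and \<open>p > q\<close> alike.\<close>

lemma rademacher_moment_comparison:
  assumes q: "2 \<le> q" and p: "0 < p"
  shows "\<exists>K\<ge>0. \<forall>n (x :: nat \<Rightarrow> 'b::real_normed_vector).
    (measure_pmf.expectation (rademacher_signs n) (\<lambda>e. norm (\<Sum>k=1..n. e k *\<^sub>R x k) powr p)) powr (1 / p)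
    \<le> K * (measure_pmf.expectation (rademacher_signs n) (\<lambda>e. norm (\<Sum>k=1..n. e k *\<^sub>R x k) powr q)) powr (1 / q)"
proof -
  obtain m where m: "p < 2 ^ m"
    using real_arch_pow[of 2 p] by auto
  define r where "r = 2 ^ m * q"
  have "2 ^ m * 1 \<le> r"
    unfolding r_def using q by (intro mult_mono) auto
  then have r: "p \<le> r" "0 < r" using m p by simp_all
  obtain K where K: "K \<ge> 0" "\<And>n (x :: nat \<Rightarrow> 'b).
    measure_pmf.expectation (rademacher_signs n) (\<lambda>e. norm (\<Sum>k=1..n. e k *\<^sub>R x k) powr r)
    \<le> K * (measure_pmf.expectation (rademacher_signs n) (\<lambda>e. norm (\<Sum>k=1..n. e k *\<^sub>R x k) powr q)) ^ (2 ^ m)"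
    using rademacher_moment_power_two[OF q, of m] unfolding r_def by blast
  show ?thesis
  proof (intro exI[of _ "2 powr (1 / p) * K powr (1 / r)"] conjI allI)
    fix n and x :: "nat \<Rightarrow> 'b"
    let ?E = "\<lambda>t. measure_pmf.expectation (rademacher_signs n) (\<lambda>e. norm (\<Sum>k=1..n. e k *\<^sub>R x k) powr t)"
    have nn: "0 \<le> ?E t" for t by simp
    have "?E p \<le> 2 * ?E r powr (p / r)"
      using p r by (intro expectation_powr_mono_exponent) auto
    also have "\<dots> \<le> 2 * (K * ?E q ^ 2 ^ m) powr (p / r)"
      using p r K(2)[of n x] by (intro mult_left_mono powr_mono2 nn) auto
    finally have "?E p powr (1 / p) \<le> (2 * (K * ?E q ^ 2 ^ m) powr (p / r)) powr (1 / p)"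
      using p nn by (intro powr_mono2) auto
    also have "\<dots> = 2 powr (1 / p) * (K * ?E q ^ 2 ^ m) powr (1 / r)"
      using p by (simp add: powr_mult powr_powr)
    also have "\<dots> = 2 powr (1 / p) * (K powr (1 / r) * (?E q ^ 2 ^ m) powr (1 / r))"
      using K(1) nn by (subst powr_mult) auto
    \<comment> \<open>The exponents cancel because \<open>2 ^ m / r = 1 / q\<close>.\<close>
    also have "(?E q ^ 2 ^ m) powr (1 / r) = ?E q powr (1 / q)"
    proof (cases "?E q = 0")
      case False
      with nn have "0 < ?E q" by (simp add: less_le)
      then have "?E q ^ 2 ^ m = ?E q powr (2 ^ m)"
        by (simp add: powr_realpow[symmetric])
      then show ?thesis
        by (simp add: powr_powr r_def)
    qed simp
    finally show "?E p powr (1 / p) \<le> 2 powr (1 / p) * K powr (1 / r) * ?E q powr (1 / q)"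
      by (simp add: mult.assoc)
  qed (use K in auto)
qed

subsection \<open>Averages of square waves\<close>

text \<open>The half period is \<open>1 / H ^ j\<close>. The wave never vanishes, so its value at a
  point can be absorbed into a random sign.\<close>

definition square_wave :: "nat \<Rightarrow> nat \<Rightarrow> real \<Rightarrow> real" where
  "square_wave H j y = (if even \<lfloor>real H ^ j * y\<rfloor> then 1 else -1)"

lemma square_wave_cases: "square_wave H j y = 1 \<or> square_wave H j y = -1"
  by (simp add: square_wave_def)

lemma square_wave_measurable [measurable]: "square_wave H j \<in> borel_measurable borel"
  unfolding square_wave_def[abs_def] by measurable

text \<open>The shift moves \<open>H ^ j * y\<close> by the integer \<open>H ^ (j - Suc k)\<close>,
  which is odd because \<open>H\<close> is, so the parity of the floor changes.\<close>

lemma square_wave_antiperiodic: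
  assumes "odd H" "k < j"
  shows "square_wave H j (y + 1 / real H ^ Suc k) = - square_wave H j y"
proof -
  have "H \<noteq> 0" using assms by (intro notI) simp
  have "real H ^ j = real H ^ (j - Suc k) * real H ^ Suc k"
    using assms by (simp only: flip: power_add) simp
  then have "real H ^ j * (y + 1 / real H ^ Suc k) = real H ^ j * y + of_int (int H ^ (j - Suc k))"
    using \<open>H \<noteq> 0\<close> by (simp add: field_simps)
  then have "\<lfloor>real H ^ j * (y + 1 / real H ^ Suc k)\<rfloor> = \<lfloor>real H ^ j * y\<rfloor> + int H ^ (j - Suc k)"
    by (metis floor_add_int)
  then show ?thesis
    using assms by (simp add: square_wave_def)
qed

text \<open>The displacement \<open>H ^ j * y\<close> is at most \<open>1 / H\<close> in absolute
  value, while \<open>H ^ j * x\<close> keeps that distance from the integers. The upper bound on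
  the fractional part is strict because the floor jumps on reaching the next integer.\<close>

lemma floor_locally_constant:
  assumes "0 < H" "1 / real H \<le> frac (real H ^ j * x)" "frac (real H ^ j * x) < 1 - 1 / real H"
    "\<bar>y\<bar> \<le> 1 / real H ^ Suc k" "j \<le> k"
  shows "\<lfloor>real H ^ j * (x + y)\<rfloor> = \<lfloor>real H ^ j * x\<rfloor>"
proof -
  have "real H ^ j * \<bar>y\<bar> \<le> real H ^ j * (1 / real H ^ Suc k)"
    using assms by (intro mult_left_mono) auto
  also have "\<dots> \<le> real H ^ k * (1 / real H ^ Suc k)"
    using assms by (intro mult_right_mono power_increasing) auto
  also have "\<dots> = 1 / real H" using assms by simp
  finally have "\<bar>real H ^ j * y\<bar> \<le> 1 / real H"
    by (simp add: abs_mult)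
  then show ?thesis
    using assms unfolding frac_def by (intro floor_unique) (auto simp: algebra_simps)
qed

text \<open>Translation by \<open>t\<close> carries the left half of the interval to the right half
  and changes the sign of \<open>g\<close>, so the two halves cancel.\<close>

lemma integral_symmetric_antiperiodic:
  fixes g :: "real \<Rightarrow> real"
  assumes [measurable]: "g \<in> borel_measurable borel" and b: "\<And>y. \<bar>g y\<bar> \<le> 1"
    and "0 < t" "\<And>y. g (y + t) = - g y"
  shows "(\<integral>y. indicator {-t..t} y * g y \<partial>lborel) = 0"
proof -
  have int: "integrable lborel (\<lambda>y. indicator {a..<c} y * g y)" for a c
  proof (rule Bochner_Integration.integrable_bound)
    show "integrable lborel (indicator {a..<c} :: real \<Rightarrow> real)"
      by (cases "a \<le> c") auto
  qed (use b in \<open>auto simp: indicator_def abs_mult\<close>)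
  have "(\<integral>y. indicator {-t..t} y * g y \<partial>lborel) =
      (\<integral>y. indicator {-t..<0} y * g y + indicator {0..<t} y * g y \<partial>lborel)"
  proof (intro integral_cong_AE)
    show "AE y in lborel. indicator {-t..t} y * g y = indicator {-t..<0} y * g y + indicator {0..<t} y * g y"
      using AE_lborel_singleton[of t] by eventually_elim (auto simp: indicator_def)
  qed simp_all
  also have "\<dots> = (\<integral>y. indicator {-t..<0} y * g y \<partial>lborel) + (\<integral>y. indicator {0..<t} y * g y \<partial>lborel)"
    by (intro Bochner_Integration.integral_add int)
  also have "(\<integral>y. indicator {0..<t} y * g y \<partial>lborel) = (\<integral>y. indicator {0..<t} (t + y) * g (t + y) \<partial>lborel)"
    using lborel_integral_real_affine[of 1 "\<lambda>y. indicator {0..<t} y * g y" t] by simp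
  also have "\<dots> = (\<integral>y. - (indicator {-t..<0} y * g y) \<partial>lborel)"
    by (intro Bochner_Integration.integral_cong) (auto simp: indicator_def assms(4) add.commute[of t])
  finally show ?thesis by simp
qed

text \<open>Serves twice: with \<open>A\<close> the averaging window around \<open>0\<close>, and
  with \<open>x = 0\<close> and \<open>A = {0..<1}\<close> for the test function itself.\<close>

lemma simple_bochner_integrable_indicator_wave:
  assumes [measurable]: "A \<in> sets borel" and fin: "emeasure lborel A < \<infinity>"
  shows "Bochner_Integration.simple_bochner_integrable lebesgue (\<lambda>y. indicator A y * square_wave H j (x + y))"
proof (rule Bochner_Integration.simple_bochner_integrable.intros)
  have "(\<lambda>y. indicator A y * square_wave H j (x + y)) \<in> borel_measurable lebesgue"
    by (intro measurable_completion) simp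
  moreover have "range (\<lambda>y. indicator A y * square_wave H j (x + y)) \<subseteq> {0, 1, -1}"
    by (auto simp: square_wave_def indicator_def)
  ultimately show "simple_function lebesgue (\<lambda>y. indicator A y * square_wave H j (x + y))"
    by (intro simple_function_borel_measurable) (auto intro: finite_subset)
  have "emeasure lebesgue {y \<in> space lebesgue. indicator A y * square_wave H j (x + y) \<noteq> 0}
    \<le> emeasure lebesgue A"
    by (intro emeasure_mono) (auto simp: indicator_def)
  also have "\<dots> < \<infinity>" using fin by simp
  finally show "emeasure lebesgue {y \<in> space lebesgue. indicator A y * square_wave H j (x + y) \<noteq> 0} \<noteq> \<infinity>"
    by simp
qed

lemma integral_square_wave_coarse:
  assumes "0 < H" "1 / real H \<le> frac (real H ^ j * x)" "frac (real H ^ j * x) < 1 - 1 / real H"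
    "j \<le> k" and t: "t = 1 / real H ^ Suc k"
  shows "(\<integral>y. indicator {-t..t} y * square_wave H j (x + y) \<partial>lebesgue) = 2 * t * square_wave H j x"
proof -
  have "0 < t" using assms by simp
  have "indicator {-t..t} y * square_wave H j (x + y) = indicator {-t..t} y * square_wave H j x" for y
    using floor_locally_constant[OF assms(1-3) _ assms(4), of y]
    by (auto simp: indicator_def square_wave_def t)
  then have "(\<integral>y. indicator {-t..t} y * square_wave H j (x + y) \<partial>lebesgue) =
    (\<integral>y. indicator {-t..t} y * square_wave H j x \<partial>lebesgue)"
    by (intro Bochner_Integration.integral_cong) auto
  then show ?thesis using \<open>0 < t\<close> by simp
qed

lemma integral_square_wave_fine:
  assumes "odd H" "k < j" and t: "t = 1 / real H ^ Suc k"
  shows "(\<integral>y. indicator {-t..t} y * square_wave H j (x + y) \<partial>lebesgue) = 0"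
proof -
  have "0 < H" using assms(1) by (cases H) auto
  then have "(\<integral>y. indicator {-t..t} y * square_wave H j (x + y) \<partial>lborel) = 0"
    using square_wave_antiperiodic[OF assms(1,2)] square_wave_cases[of H j]
    by (intro integral_symmetric_antiperiodic) (auto simp: t add.assoc[symmetric] square_wave_def)
  then show ?thesis by (subst integral_completion) auto
qed

section \<open>Averages of the test function\<close>

text \<open>The constant sequence \<open>f\<close> approximates \<open>f\<close>. The integrands met
  below are simple, so this evaluates their strong integrals.\<close>

lemma strong_integral_simple:
  assumes "Bochner_Integration.simple_bochner_integrable M f"
  shows "strong_integral M f = Bochner_Integration.simple_bochner_integral M f"
proof -
  have "simple_function M f"
    using assms by (simp add: Bochner_Integration.simple_bochner_integrable.simps)
  then have *: "has_strong_integral M f (Bochner_Integration.simple_bochner_integral M f)"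
    unfolding has_strong_integral_def strongly_measurable_def
    by (intro conjI exI[of _ "\<lambda>_. f"]) (auto simp: assms)
  show ?thesis
    unfolding strong_integral_def using * has_strong_integral_unique[OF _ *]
    by (metis the_equality)
qed

text \<open>Reduces a vector-valued integral to scalar ones, by linearity of
  \<open>a \<mapsto> a *\<^sub>R v j\<close>. Both claims are proved together because additivity of
  the integral in the induction uses integrability of the partial sum.\<close>

lemma simple_bochner_scaleR_sum:
  fixes g :: "'i \<Rightarrow> 'a \<Rightarrow> real" and v :: "'i \<Rightarrow> 'b::real_vector"
  assumes "finite J" "\<And>j. j \<in> J \<Longrightarrow> Bochner_Integration.simple_bochner_integrable M (g j)"
  shows "Bochner_Integration.simple_bochner_integrable M (\<lambda>y. \<Sum>j\<in>J. g j y *\<^sub>R v j) \<and>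
    Bochner_Integration.simple_bochner_integral M (\<lambda>y. \<Sum>j\<in>J. g j y *\<^sub>R v j) =
    (\<Sum>j\<in>J. integral\<^sup>L M (g j) *\<^sub>R v j)"
  using assms
proof (induction J rule: finite_induct)
  case empty
  have "Bochner_Integration.simple_bochner_integrable M (\<lambda>_. 0 :: 'b)"
    by (intro Bochner_Integration.simple_bochner_integrable.intros) auto
  then show ?case by (auto simp: Bochner_Integration.simple_bochner_integral_def intro!: sum.neutral)
next
  case (insert i J)
  have i: "Bochner_Integration.simple_bochner_integrable M (g i)" using insert by simp
  then have i': "Bochner_Integration.simple_bochner_integrable M (\<lambda>y. g i y *\<^sub>R v i)"
    by (intro Bochner_Integration.simple_bochner_integrable_compose2[OF _ i i, of "\<lambda>a b. a *\<^sub>R v i"]) simp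
  have "linear (\<lambda>a. a *\<^sub>R v i)"
    by (intro linearI) (auto simp: scaleR_add_left)
  from Bochner_Integration.simple_bochner_integral_linear[OF this i]
  have "Bochner_Integration.simple_bochner_integral M (\<lambda>y. g i y *\<^sub>R v i) = integral\<^sup>L M (g i) *\<^sub>R v i"
    by (simp add: simple_bochner_integrable_eq_integral[OF i])
  then show ?case
    using insert i' Bochner_Integration.simple_bochner_integral_add[OF i', of "\<lambda>y. \<Sum>j\<in>J. g j y *\<^sub>R v j"]
      Bochner_Integration.simple_bochner_integrable_compose2[of "(+)", OF _ i', of "\<lambda>y. \<Sum>j\<in>J. g j y *\<^sub>R v j"]
    by simp
qed

definition wave_sum :: "nat \<Rightarrow> nat \<Rightarrow> (nat \<Rightarrow> real) \<Rightarrow> (nat \<Rightarrow> 'b::real_vector) \<Rightarrow> real \<Rightarrow> 'b" where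
  "wave_sum H n e v y = (\<Sum>j=1..n. (indicator {0..<1} y * (e j * square_wave H j y)) *\<^sub>R v j)"

text \<open>On the averaging window the waves with \<open>j \<le> k\<close> are constant and those
  with \<open>j > k\<close> have integral zero. The condition \<open>good\<close> includes
  \<open>j = 0\<close>, which keeps the window inside the unit interval, away from the
  cut-off.\<close>

lemma average_wave_sum:
  fixes v :: "nat \<Rightarrow> 'b::real_normed_vector"
  assumes H: "odd H" and x: "x \<in> {0..<1}" and k: "k \<le> n"
    and good: "\<And>j. j \<le> n \<Longrightarrow> 1 / real H \<le> frac (real H ^ j * x) \<and> frac (real H ^ j * x) < 1 - 1 / real H"
  shows "average (wave_sum H n e v) (1 / real H ^ Suc k) x = (\<Sum>j=1..k. (e j * square_wave H j x) *\<^sub>R v j)"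
proof -
  define t where "t = 1 / real H ^ Suc k"
  have "0 < H" using H by (cases H) auto
  then have t: "0 < t" by (simp add: t_def)
  define g where "g j y = indicator {-t..t} y * square_wave H j (x + y)" for j y
  have sb: "Bochner_Integration.simple_bochner_integrable lebesgue (g j)" for j
    unfolding g_def[abs_def] using t by (intro simple_bochner_integrable_indicator_wave) auto
  \<comment> \<open>The case \<open>j = 0\<close> of \<open>good\<close>: \<open>x\<close> and
    \<open>x + y\<close> have the same floor.\<close>
  have "x + y \<in> {0..<1}" if "y \<in> {-t..t}" for y
  proof -
    have "\<lfloor>real H ^ 0 * (x + y)\<rfloor> = \<lfloor>real H ^ 0 * x\<rfloor>"
      using that good[of 0]
      by (intro floor_locally_constant[OF \<open>0 < H\<close>, where k = k]) (auto simp: t_def abs_le_iff)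
    moreover have "\<lfloor>x\<rfloor> = 0" using x by (simp add: floor_eq_iff)
    ultimately show ?thesis by (simp add: floor_eq_iff)
  qed
  then have "(\<lambda>y. indicator {-t..t} y *\<^sub>R wave_sum H n e v (x + y)) = (\<lambda>y. \<Sum>j=1..n. g j y *\<^sub>R e j *\<^sub>R v j)"
    by (auto simp: wave_sum_def g_def fun_eq_iff scaleR_sum_right indicator_def mult.commute intro!: sum.cong)
  then have "strong_integral lebesgue (\<lambda>y. indicator {-t..t} y *\<^sub>R wave_sum H n e v (x + y)) =
      (\<Sum>j=1..n. integral\<^sup>L lebesgue (g j) *\<^sub>R e j *\<^sub>R v j)"
    using simple_bochner_scaleR_sum[of "{1..n}" lebesgue g "\<lambda>j. e j *\<^sub>R v j"] sb
    by (simp add: strong_integral_simple)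
  also have "\<dots> = (\<Sum>j=1..k. (2 * t * square_wave H j x) *\<^sub>R e j *\<^sub>R v j)"
  proof (intro sum.mono_neutral_cong_right)
    show "\<forall>j\<in>{1..n} - {1..k}. integral\<^sup>L lebesgue (g j) *\<^sub>R e j *\<^sub>R v j = 0"
      using integral_square_wave_fine[OF H _ t_def] by (auto simp: g_def[abs_def])
    show "integral\<^sup>L lebesgue (g j) *\<^sub>R e j *\<^sub>R v j = (2 * t * square_wave H j x) *\<^sub>R e j *\<^sub>R v j"
      if "j \<in> {1..k}" for j
      using integral_square_wave_coarse[OF \<open>0 < H\<close> _ _ _ t_def, of j x] good[of j] that k
      by (auto simp: g_def[abs_def])
  qed (use k in auto)
  also have "\<dots> = (2 * t) *\<^sub>R (\<Sum>j=1..k. (e j * square_wave H j x) *\<^sub>R v j)"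
    by (simp add: scaleR_sum_right mult_ac)
  finally show ?thesis
    unfolding average_def t_def[symmetric] using t by simp
qed

section \<open>Lower bound for the variation\<close>

lemma ennreal_powr_mono: "x \<le> y \<Longrightarrow> 0 \<le> a \<Longrightarrow> ennreal_powr x a \<le> ennreal_powr y a"
  by (cases x; cases y) (auto simp: ennreal_powr_def top_unique intro!: ennreal_leI powr_mono2)

lemma ennreal_powr_ennreal [simp]: "0 \<le> r \<Longrightarrow> ennreal_powr (ennreal r) a = ennreal (r powr a)"
  by (simp add: ennreal_powr_def)

text \<open>Discards the initial term and the tail of the series, all terms being
  nonnegative.\<close>

lemma q_variation_ge:
  assumes "0 < q" "strict_mono t" "\<And>k. 0 < t k"
  shows "ennreal ((\<Sum>i<n. norm (a (t (Suc i)) - a (t i)) powr q) powr (1 / q)) \<le> q_variation q a"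
proof -
  let ?d = "\<lambda>i. norm (a (t (Suc i)) - a (t i)) powr q"
  have "ennreal (\<Sum>i<n. ?d i) = (\<Sum>i<n. ennreal (?d i))"
    by (simp add: sum_ennreal)
  also have "\<dots> \<le> (\<Sum>i. ennreal (?d i))"
    by (intro sum_le_suminf) auto
  also have "\<dots> \<le> ennreal (norm (a (t 0)) powr q) + (\<Sum>i. ennreal (?d i))"
    by simp
  finally have "ennreal_powr (ennreal (\<Sum>i<n. ?d i)) (1 / q) \<le>
      ennreal_powr (ennreal (norm (a (t 0)) powr q) + (\<Sum>i. ennreal (?d i))) (1 / q)"
    using assms by (intro ennreal_powr_mono) auto
  also have "\<dots> \<le> q_variation q a"
    unfolding q_variation_def using assms by (intro SUP_upper) auto
  finally show ?thesis by (simp add: sum_nonneg)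
qed

lemma average_variation_wave_sum_ge:
  fixes v :: "nat \<Rightarrow> 'b::real_normed_vector"
  assumes "0 < q" and H: "odd H" "1 < H" and x: "x \<in> {0..<1}"
    and e: "\<And>j. j \<in> {1..n} \<Longrightarrow> \<bar>e j\<bar> = 1"
    and good: "\<And>j. j \<le> n \<Longrightarrow> 1 / real H \<le> frac (real H ^ j * x) \<and> frac (real H ^ j * x) < 1 - 1 / real H"
  shows "ennreal ((\<Sum>k=1..n. norm (v k) powr q) powr (1 / q)) \<le> average_variation q (wave_sum H n e v) x"
proof -
  \<comment> \<open>For \<open>i \<le> n\<close> this is the radius
    \<open>1 / H ^ Suc (n - i)\<close>: radii grow with \<open>i\<close>, so the number
    \<open>n - i\<close> of surviving waves falls. Larger indices only continue the sequence, which
    has to be infinite.\<close>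
  define t where "t i = real H ^ i / real H ^ Suc n" for i
  define a where "a s = average (wave_sum H n e v) s x" for s
  have t: "strict_mono t" "\<And>i. 0 < t i"
    using H unfolding t_def by (auto intro!: strict_monoI divide_strict_right_mono power_strict_increasing)
  have at: "a (t i) = (\<Sum>j=1..n - i. (e j * square_wave H j x) *\<^sub>R v j)" if "i \<le> n" for i
  proof -
    have "real H ^ Suc n = real H ^ i * real H ^ Suc (n - i)"
      using that by (simp add: Suc_diff_le flip: power_add)
    then have "t i = 1 / real H ^ Suc (n - i)"
      using H by (simp add: t_def)
    then show ?thesis
      unfolding a_def using average_wave_sum[OF H(1) x _ good, of "n - i" n e v] by simp
  qed
  have "(\<Sum>i<n. norm (a (t (Suc i)) - a (t i)) powr q) = (\<Sum>i<n. norm (v (n - i)) powr q)"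
  proof (intro sum.cong refl)
    fix i assume "i \<in> {..<n}"
    then have i: "n - i = Suc (n - Suc i)" "i < n" by auto
    \<comment> \<open>Passing from \<open>i\<close> to \<open>Suc i\<close> removes exactly the
      summand \<open>n - i\<close>. At \<open>i = n\<close> the average is the empty sum, so each of
      \<open>v 1, \<dots>, v n\<close> contributes one increment.\<close>
    have "norm (a (t (Suc i)) - a (t i)) = norm ((e (n - i) * square_wave H (n - i) x) *\<^sub>R v (n - i))"
      using i by (simp add: at norm_minus_commute)
    also have "\<dots> = norm (v (n - i))"
      using e[of "n - i"] i square_wave_cases[of H "n - i" x] by (auto simp: abs_mult)
    finally show "norm (a (t (Suc i)) - a (t i)) powr q = norm (v (n - i)) powr q" by simp
  qed
  also have "\<dots> = (\<Sum>k=1..n. norm (v k) powr q)"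
    by (rule sum.reindex_bij_witness[of _ "\<lambda>k. n - k" "\<lambda>i. n - i"]) auto
  finally show ?thesis
    using q_variation_ge[OF \<open>0 < q\<close> t, of a n]
    by (simp add: average_variation_def a_def[abs_def])
qed

section \<open>Measure of the good points\<close>

text \<open>The set is covered by \<open>2 * c\<close> intervals of length \<open>d / c\<close>, one
  at each end of every cell from \<open>i / c\<close> to \<open>(i + 1) / c\<close>.\<close>

lemma emeasure_frac_near_integers:
  assumes "0 < c" "0 \<le> d" "d \<le> 1"
  shows "emeasure lborel {x \<in> {0..<1}. frac (real c * x) < d \<or> 1 - d \<le> frac (real c * x)} \<le> ennreal (2 * d)"
proof -
  let ?A = "\<lambda>i. {real i / c..(real i + d) / c} \<union> {(real i + 1 - d) / c..(real i + 1) / c}"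
  have "{x \<in> {0..<1}. frac (real c * x) < d \<or> 1 - d \<le> frac (real c * x)} \<subseteq> (\<Union>i<c. ?A i)"
  proof
    fix x :: real
    assume x: "x \<in> {x \<in> {0..<1}. frac (real c * x) < d \<or> 1 - d \<le> frac (real c * x)}"
    define i where "i = nat \<lfloor>real c * x\<rfloor>"
    have i: "real i = real_of_int \<lfloor>real c * x\<rfloor>" using x by (simp add: i_def)
    have "real c * x < real c * 1"
      using x assms by (intro mult_strict_left_mono) auto
    then have "real i < real c" unfolding i by linarith
    then have ic: "i < c" by simp
    have "x \<in> ?A i"
    proof -
      have "real i \<le> real c * x" "real c * x < real i + 1" unfolding i by linarith+
      moreover have "real c * x < real i + d \<or> real i + 1 - d \<le> real c * x"
        using x unfolding i frac_def by auto
      ultimately show ?thesis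
        using assms by (auto simp: field_simps)
    qed
    with ic show "x \<in> (\<Union>i<c. ?A i)" by blast
  qed
  then have "emeasure lborel {x \<in> {0..<1}. frac (real c * x) < d \<or> 1 - d \<le> frac (real c * x)}
      \<le> emeasure lborel (\<Union>i<c. ?A i)"
    by (intro emeasure_mono) auto
  also have "\<dots> \<le> (\<Sum>i<c. emeasure lborel (?A i))"
    by (intro emeasure_subadditive_finite) auto
  also have "\<dots> \<le> (\<Sum>i<c. ennreal (2 * d / c))"
  proof (intro sum_mono)
    fix i
    have "emeasure lborel (?A i) \<le> emeasure lborel {real i / c..(real i + d) / c} +
        emeasure lborel {(real i + 1 - d) / c..(real i + 1) / c}"
      by (intro emeasure_subadditive) auto
    also have "\<dots> = ennreal (d / c) + ennreal (d / c)"
      using assms by (simp add: divide_right_mono flip: diff_divide_distrib)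
    also have "\<dots> = ennreal (2 * d / c)"
      using assms by (simp flip: ennreal_plus add_divide_distrib)
    finally show "emeasure lborel (?A i) \<le> ennreal (2 * d / c)" .
  qed
  also have "\<dots> = ennreal (2 * d)"
    using assms by (subst sum_ennreal) auto
  finally show ?thesis .
qed

text \<open>Union bound: each of the \<open>n + 1\<close> conditions fails on measure at most
  \<open>2 / H\<close>, in total at most \<open>1 / 2\<close>.\<close>

lemma emeasure_good_points:
  assumes "4 * (real n + 1) \<le> real H"
  shows "ennreal (1 / 2) \<le> emeasure lborel
    {x \<in> {0..<1}. \<forall>j\<le>n. 1 / real H \<le> frac (real H ^ j * x) \<and> frac (real H ^ j * x) < 1 - 1 / real H}"
    (is "_ \<le> emeasure _ ?G")
proof -
  let ?B = "\<lambda>j. {x \<in> {0..<1}. frac (real (H ^ j) * x) < 1 / real H \<or> 1 - 1 / real H \<le> frac (real (H ^ j) * x)}"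
  have H: "1 \<le> real H" "0 < H" using assms by (auto intro!: Nat.gr0I)
  have [measurable]: "(\<lambda>x::real. frac (c * x)) \<in> borel_measurable borel" for c
    unfolding frac_def by measurable
  have "1 = emeasure lborel {0..<1::real}" by simp
  also have "\<dots> \<le> emeasure lborel (?G \<union> (\<Union>j\<le>n. ?B j))"
  proof (intro emeasure_mono)
    show "{0..<1} \<subseteq> ?G \<union> (\<Union>j\<le>n. ?B j)"
      by (auto simp: not_le not_less)
  qed auto
  also have "\<dots> \<le> emeasure lborel ?G + emeasure lborel (\<Union>j\<le>n. ?B j)"
    by (intro emeasure_subadditive) auto
  also have "emeasure lborel (\<Union>j\<le>n. ?B j) \<le> (\<Sum>j\<le>n. emeasure lborel (?B j))"
    by (intro emeasure_subadditive_finite) auto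
  also have "(\<Sum>j\<le>n. emeasure lborel (?B j)) \<le> (\<Sum>j\<le>n. ennreal (2 * (1 / real H)))"
    using H by (intro sum_mono emeasure_frac_near_integers) auto
  also have "\<dots> = ennreal ((real n + 1) * (2 / real H))"
    by (subst sum_ennreal) (auto simp: algebra_simps)
  also have "\<dots> \<le> ennreal (1 / 2)"
    using assms H by (intro ennreal_leI) (auto simp: field_simps)
  finally have "1 \<le> emeasure lborel ?G + ennreal (1 / 2)" by (simp add: add_left_mono)
  moreover have "ennreal (1 / 2) \<le> g" if "1 \<le> g + ennreal (1 / 2)" for g
  proof (cases g)
    case (real r)
    then have "ennreal 1 \<le> ennreal (r + 1 / 2)"
      using that by (subst ennreal_plus) auto
    then have "1 \<le> r + 1 / 2"
      using real by (subst (asm) ennreal_le_iff) auto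
    then have "1 / 2 \<le> r" by simp
    then show ?thesis unfolding real(2) by (intro ennreal_leI)
  qed simp
  ultimately show ?thesis by blast
qed

subsection \<open>From the variational inequality to cotype\<close>

lemma simple_bochner_integrable_wave_sum:
  "Bochner_Integration.simple_bochner_integrable lebesgue (wave_sum H n e v)"
proof -
  have "wave_sum H n e v = (\<lambda>y. \<Sum>j=1..n. (indicator {0..<1} y * square_wave H j (0 + y)) *\<^sub>R e j *\<^sub>R v j)"
    by (auto simp: wave_sum_def fun_eq_iff mult_ac)
  moreover have "Bochner_Integration.simple_bochner_integrable lebesgue
      (\<lambda>y. \<Sum>j=1..n. (indicator {0..<1} y * square_wave H j (0 + y)) *\<^sub>R e j *\<^sub>R v j)"
    by (intro simple_bochner_scaleR_sum[THEN conjunct1] simple_bochner_integrable_indicator_wave) auto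
  ultimately show ?thesis by simp
qed

lemma integrable_norm_wave_sum_powr:
  fixes v :: "nat \<Rightarrow> 'b::real_normed_vector"
  shows "integrable lebesgue (\<lambda>y. norm (wave_sum H n e v y) powr p)"
proof -
  have "Bochner_Integration.simple_bochner_integrable lebesgue (\<lambda>y. norm (wave_sum H n e v y) powr p)"
    using Bochner_Integration.simple_bochner_integrable_compose2[of "\<lambda>a b. norm a powr p",
        OF _ simple_bochner_integrable_wave_sum simple_bochner_integrable_wave_sum]
    by simp
  then show ?thesis
    using has_bochner_integral_simple_bochner_integrable integrable.intros by blast
qed

lemma Lp_norm_wave_sum:
  fixes v :: "nat \<Rightarrow> 'b::real_normed_vector"
  shows "Lp_norm lebesgue p (\<lambda>y. ennreal (norm (wave_sum H n e v y))) =
    ennreal ((\<integral>y. norm (wave_sum H n e v y) powr p \<partial>lebesgue) powr (1 / p))"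
  unfolding Lp_norm_def
  by (simp add: nn_integral_eq_integral[OF integrable_norm_wave_sum_powr])

lemma wave_sum_in_Lp_space: "wave_sum H n e v \<in> Lp_space lebesgue p"
proof -
  have "simple_function lebesgue (wave_sum H n e v)"
    using simple_bochner_integrable_wave_sum[of H n e v]
    by (simp add: Bochner_Integration.simple_bochner_integrable.simps)
  then show ?thesis
    unfolding Lp_space_def strongly_measurable_def
    by (auto simp: Lp_norm_wave_sum intro!: exI[of _ "\<lambda>_. wave_sum H n e v"])
qed

text \<open>For fixed \<open>y\<close>, the signs \<open>e j * square_wave H j y\<close> have the same law as \<open>e j\<close>; thus the square
  waves themselves need not be independent.\<close>

lemma expectation_integral_wave_sum:
  fixes v :: "nat \<Rightarrow> 'b::real_normed_vector"
  shows "measure_pmf.expectation (rademacher_signs n)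
      (\<lambda>e. \<integral>y. norm (wave_sum H n e v y) powr p \<partial>lebesgue)
    = measure_pmf.expectation (rademacher_signs n) (\<lambda>e. norm (\<Sum>k=1..n. e k *\<^sub>R v k) powr p)"
proof -
  let ?M = "rademacher_signs n"
  let ?E = "measure_pmf.expectation ?M (\<lambda>e. norm (\<Sum>k=1..n. e k *\<^sub>R v k) powr p)"
  \<comment> \<open>Writing the expectation as a finite sum turns the exchange with the integral
    into linearity.\<close>
  have E: "measure_pmf.expectation ?M g = (\<Sum>e\<in>set_pmf ?M. g e * pmf ?M e)" for g :: "_ \<Rightarrow> real"
    by (rule integral_measure_pmf_real) auto
  have "measure_pmf.expectation ?M (\<lambda>e. \<integral>y. norm (wave_sum H n e v y) powr p \<partial>lebesgue) =
      (\<integral>y. (\<Sum>e\<in>set_pmf ?M. norm (wave_sum H n e v y) powr p * pmf ?M e) \<partial>lebesgue)"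
    unfolding E by (subst Bochner_Integration.integral_sum) (auto intro: integrable_norm_wave_sum_powr)
  also have "\<dots> = (\<integral>y. measure_pmf.expectation ?M (\<lambda>e. norm (wave_sum H n e v y) powr p) \<partial>lebesgue)"
    unfolding E ..
  also have "\<dots> = (\<integral>y. indicator {0..<1::real} y * ?E \<partial>lebesgue)"
  proof (rule Bochner_Integration.integral_cong[OF refl])
    fix y
    show "measure_pmf.expectation ?M (\<lambda>e. norm (wave_sum H n e v y) powr p) = indicator {0..<1} y * ?E"
      using expectation_rademacher_signs_flip[of "\<lambda>j. square_wave H j y" n "\<lambda>z. norm z powr p" v]
        square_wave_cases[of H _ y]
      by (auto simp: wave_sum_def indicator_def)
  qed
  also have "\<dots> = ?E" by simp
  finally show ?thesis .
qed

text \<open>For each choice of signs the test function satisfies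
  \<open>A powr p / 2 \<le> C powr p * I e\<close>. The left-hand side does not depend on
  \<open>e\<close>, and the expectation of \<open>I e\<close> is the \<open>p\<close>-th moment of
  the Rademacher sum.\<close>

lemma variation_bound_imp_moment_bound:
  fixes v :: "nat \<Rightarrow> 'b::real_normed_vector"
  assumes "0 < q" "0 < p" "0 \<le> C"
    and bound: "\<And>f :: real \<Rightarrow> 'b. f \<in> Lp_space lebesgue p \<Longrightarrow>
      Lp_norm lebesgue p (average_variation q f) \<le> ennreal C * Lp_norm lebesgue p (\<lambda>x. ennreal (norm (f x)))"
  shows "(\<Sum>k=1..n. norm (v k) powr q) powr (1 / q) \<le>
    2 powr (1 / p) * C * measure_pmf.expectation (rademacher_signs n)
      (\<lambda>e. norm (\<Sum>k=1..n. e k *\<^sub>R v k) powr p) powr (1 / p)"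
proof -
  \<comment> \<open>Odd, greater than 1 also for \<open>n = 0\<close>, and at least
    \<open>4 * (n + 1)\<close> as the measure estimate demands.\<close>
  define H :: nat where "H = 4 * n + 5"
  have H: "odd H" "1 < H" "4 * (real n + 1) \<le> real H" by (auto simp: H_def)
  define A where "A = (\<Sum>k=1..n. norm (v k) powr q) powr (1 / q)"
  have A: "0 \<le> A" by (simp add: A_def)
  define I where "I e = (\<integral>y. norm (wave_sum H n e v y) powr p \<partial>lebesgue)" for e
  have I: "0 \<le> I e" for e by (simp add: I_def)
  define G where "G = {x \<in> {0..<1}. \<forall>j\<le>n. 1 / real H \<le> frac (real H ^ j * x) \<and> frac (real H ^ j * x) < 1 - 1 / real H}"
  have [measurable]: "(\<lambda>x::real. frac (c * x)) \<in> borel_measurable borel" for c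
    unfolding frac_def by measurable
  have G: "G \<in> sets borel"
    unfolding G_def by measurable
  have "A powr p / 2 \<le> C powr p * I e" if e: "e \<in> set_pmf (rademacher_signs n)" for e
  proof -
    have abs_e: "\<bar>e j\<bar> = 1" if "j \<in> {1..n}" for j
      using e that unfolding set_rademacher_signs PiE_dflt_def by force
    have "ennreal (A powr p / 2) = ennreal (A powr p) * ennreal (1 / 2)"
      using A by (subst ennreal_mult[symmetric]) auto
    also have "\<dots> \<le> ennreal (A powr p) * emeasure lebesgue G"
      using emeasure_good_points[OF H(3)] G by (intro mult_left_mono) (auto simp: G_def)
    also have "\<dots> = (\<integral>\<^sup>+x. ennreal (A powr p) * indicator G x \<partial>lebesgue)"
      using G by (subst nn_integral_cmult_indicator) auto
    also have "\<dots> \<le> (\<integral>\<^sup>+x. ennreal_powr (average_variation q (wave_sum H n e v) x) p \<partial>lebesgue)"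
    proof (intro nn_integral_mono)
      fix x
      show "ennreal (A powr p) * indicator G x \<le> ennreal_powr (average_variation q (wave_sum H n e v) x) p"
      proof (cases "x \<in> G")
        case True
        then have "ennreal A \<le> average_variation q (wave_sum H n e v) x"
          unfolding A_def
          by (intro average_variation_wave_sum_ge[OF \<open>0 < q\<close> H(1,2)] abs_e) (auto simp: G_def)
        then have "ennreal_powr (ennreal A) p \<le> ennreal_powr (average_variation q (wave_sum H n e v) x) p"
          using \<open>0 < p\<close> by (intro ennreal_powr_mono) auto
        then show ?thesis using A True by simp
      qed simp
    qed
    finally have "ennreal_powr (ennreal (A powr p / 2)) (1 / p) \<le>
        Lp_norm lebesgue p (average_variation q (wave_sum H n e v))"
      unfolding Lp_norm_def using \<open>0 < p\<close> by (intro ennreal_powr_mono) auto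
    also have "\<dots> \<le> ennreal C * Lp_norm lebesgue p (\<lambda>x. ennreal (norm (wave_sum H n e v x)))"
      by (intro bound wave_sum_in_Lp_space)
    also have "\<dots> = ennreal (C * I e powr (1 / p))"
      using \<open>0 \<le> C\<close> by (simp add: Lp_norm_wave_sum ennreal_mult flip: I_def)
    finally have "(A powr p / 2) powr (1 / p) \<le> C * I e powr (1 / p)"
      using A \<open>0 \<le> C\<close> by simp
    \<comment> \<open>Raising to the power \<open>p\<close> makes the bound linear in
      \<open>I e\<close>, so that expectations can be taken.\<close>
    then have "((A powr p / 2) powr (1 / p)) powr p \<le> (C * I e powr (1 / p)) powr p"
      using \<open>0 < p\<close> by (intro powr_mono2) auto
    then show ?thesis
      using \<open>0 < p\<close> \<open>0 \<le> C\<close> I A by (simp add: powr_powr powr_mult)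
  qed
  then have "measure_pmf.expectation (rademacher_signs n) (\<lambda>_. A powr p / 2) \<le>
      measure_pmf.expectation (rademacher_signs n) (\<lambda>e. C powr p * I e)"
    by (intro integral_mono_AE) (auto simp: AE_measure_pmf_iff)
  then have "A powr p \<le> 2 * (C powr p * measure_pmf.expectation (rademacher_signs n)
      (\<lambda>e. norm (\<Sum>k=1..n. e k *\<^sub>R v k) powr p))"
    by (simp add: I_def expectation_integral_wave_sum)
  then have "(A powr p) powr (1 / p) \<le> (2 * (C powr p * measure_pmf.expectation (rademacher_signs n)
      (\<lambda>e. norm (\<Sum>k=1..n. e k *\<^sub>R v k) powr p))) powr (1 / p)"
    using \<open>0 < p\<close> by (intro powr_mono2) auto
  then show ?thesis
    unfolding A_def[symmetric] using \<open>0 < p\<close> \<open>0 \<le> C\<close> A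
    by (simp add: powr_powr powr_mult mult.assoc)
qed

theorem theorem3p1:
  fixes q :: real
  assumes "2 \<le> q"
    and "\<exists>p C :: real. 1 < p \<and> 0 \<le> C \<and>
           (\<forall>f \<in> Lp_space lebesgue p :: (real \<Rightarrow> 'b::banach) set.
              Lp_norm lebesgue p (average_variation q f)
                \<le> ennreal C * Lp_norm lebesgue p (\<lambda>x. ennreal (norm (f x))))"
  shows "rademacher_cotype q TYPE('b)"
proof -
  obtain p C where pC: "1 < p" "0 \<le> C" "\<And>f :: real \<Rightarrow> 'b. f \<in> Lp_space lebesgue p \<Longrightarrow>
      Lp_norm lebesgue p (average_variation q f) \<le> ennreal C * Lp_norm lebesgue p (\<lambda>x. ennreal (norm (f x)))"
    using assms(2) by blast
  let ?E = "\<lambda>n t (v :: nat \<Rightarrow> 'b). measure_pmf.expectation (rademacher_signs n)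
    (\<lambda>e. norm (\<Sum>k=1..n. e k *\<^sub>R v k) powr t)"
  \<comment> \<open>The constant \<open>K\<close> is uniform in \<open>n\<close> and
    \<open>v\<close>, as the cotype constant must be.\<close>
  obtain K where K: "\<And>n v. ?E n p v powr (1 / p) \<le> K * ?E n q v powr (1 / q)"
    using rademacher_moment_comparison[OF assms(1), of p] pC(1) by fastforce
  show ?thesis
    unfolding rademacher_cotype_def
  proof (intro exI allI)
    fix n and v :: "nat \<Rightarrow> 'b"
    have "(\<Sum>k=1..n. norm (v k) powr q) powr (1 / q) \<le> 2 powr (1 / p) * C * ?E n p v powr (1 / p)"
      using assms(1) pC by (intro variation_bound_imp_moment_bound) auto
    also have "\<dots> \<le> 2 powr (1 / p) * C * (K * ?E n q v powr (1 / q))"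
      using pC(2) by (intro mult_left_mono K) auto
    finally show "(\<Sum>k=1..n. norm (v k) powr q) powr (1 / q) \<le>
        (2 powr (1 / p) * C * K) * ?E n q v powr (1 / q)"
      by (simp add: mult.assoc)
  qed
qed

end
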